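(* Let $X,Y$ be two real $n\times n$ matrices. Then $$\|[X,Y]\|^2\le 2\,\|X\|^2\,\|Y\|^2 .$$
   Context: For an $n\times n$ real matrix $A=(a_{ij})$, $\|A\|=\big(\sum_{i,j=1}^n a_{ij}^2\big)^{1/2}$ is its Hilbert-Schmidt norm, and $[X,Y]=XY-YX$ is the commutator. *)

theory Defs
  imports "HOL-Analysis.Analysis"
begin

definition hs_norm :: "real ^ 'n ^ 'n \<Rightarrow> real" where
  "hs_norm A = sqrt (\<Sum>i\<in>UNIV. \<Sum>j\<in>UNIV. (A $ i $ j)\<^sup>2)"

text \<open>Here \<open>**\<close> is the matrix product; \<open>*\<close> on this type is componentwise.\<close>

definition commutator :: "real ^ 'n ^ 'n \<Rightarrow> real ^ 'n ^ 'n \<Rightarrow> real ^ 'n ^ 'n" where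
  "commutator X Y = X ** Y - Y ** X"

lemma hs_norm_eq_norm: "hs_norm A = norm A"
  by (simp add: hs_norm_def norm_vec_def L2_set_def sum_nonneg)

end

theory Submission imports Defs begin

text \<open>
  The idea is to maximise \<open>\<parallel>[X,W]\<parallel>\<close> over unit matrices \<open>W\<close> and to use the fact that the maximum is
  attained on a whole plane, which leaves room to impose one linear condition on \<open>W\<close>.

  With respect to the Hilbert-Schmidt inner product the adjoint of \<open>[X,\<cdot>]\<close> is \<open>[X\<^sup>T,\<cdot>]\<close>.  Hence a
  maximiser \<open>A\<close> comes with a unit matrix \<open>B\<close> such that \<open>[X,A] = m B\<close> and \<open>[X\<^sup>T,B] = m A\<close>, where \<open>m\<close>
  is the operator norm of \<open>[X,\<cdot>]\<close> (\<open>top_singular_pair\<close>).  Transposing the second equation gives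
  \<open>[X,B\<^sup>T] = - m A\<^sup>T\<close>, so \<open>B\<^sup>T\<close> is a maximiser too; and it is orthogonal to \<open>A\<close>, because
  \<open>m \<langle>B,A\<^sup>T\<rangle> = tr([X,A] A) = 0\<close>.  It follows that \<open>\<parallel>[X,W]\<parallel> = m \<parallel>W\<parallel>\<close> for every \<open>W\<close> in the span of
  \<open>A\<close> and \<open>B\<^sup>T\<close>.

  Now let \<open>u, v\<close> be top singular vectors of \<open>X\<close>, so that \<open>X v = s u\<close> and \<open>X\<^sup>T u = s v\<close> with \<open>s\<close> the
  operator norm of \<open>X\<close>.  Some nonzero \<open>W\<close> in the plane satisfies \<open>v \<bullet> W v = u \<bullet> W u\<close>, and for such \<open>W\<close>
  the inequality can be proved directly (\<open>commutator_bound_of_diagonal_eq\<close>).  Split \<open>[X,W]\<close> into four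
  blocks along \<open>u, u\<^sup>\<bottom>\<close> on the left and \<open>v, v\<^sup>\<bottom>\<close> on the right.  The condition says precisely that the
  \<open>(u,v)\<close> block vanishes.  Put \<open>X' = X - s u v\<^sup>T\<close>.  Each of the other blocks is a difference of two
  products in which one factor is a block of \<open>W\<close> and the other is \<open>s u v\<^sup>T\<close> or \<open>X'\<close>, and \<open>s u v\<^sup>T\<close>
  occurs at most once.  Multiplication by \<open>s u v\<^sup>T\<close> costs a factor \<open>s\<close>, and multiplication by \<open>X'\<close>
  costs at most \<open>q = min s \<parallel>X'\<parallel>\<close>.  Since \<open>2 q\<^sup>2 \<le> s\<^sup>2 + q\<^sup>2 \<le> s\<^sup>2 + \<parallel>X'\<parallel>\<^sup>2 = \<parallel>X\<parallel>\<^sup>2\<close>, Cauchy-Schwarz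
  bounds the square of each block by \<open>\<parallel>X\<parallel>\<^sup>2\<close> times the sum of the squares of the two blocks of \<open>W\<close>
  involved.  The blocks of \<open>W\<close> that occur come from two orthogonal decompositions of \<open>W\<close>, along
  \<open>(v, v\<^sup>\<bottom>)\<close> and along \<open>(u, u\<^sup>\<bottom>)\<close>, each block at most once; so their squares add up to at most
  \<open>2 \<parallel>W\<parallel>\<^sup>2\<close>.  Hence \<open>m\<^sup>2 \<le> 2 \<parallel>X\<parallel>\<^sup>2\<close>, and \<open>\<parallel>[X,Y]\<parallel> \<le> m \<parallel>Y\<parallel>\<close> for all \<open>Y\<close>.
\<close>

section \<open>Top singular pairs\<close>

text \<open>
  Compactness gives a unit vector \<open>v\<close> maximising \<open>\<parallel>L v\<parallel>\<close>.  That \<open>L' u = s v\<close> needs no derivatives: it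
  is the equality case of Cauchy-Schwarz, since \<open>v \<bullet> L' u = s\<close> while \<open>\<parallel>L' u\<parallel> \<le> s\<close>.  The lemma is
  applied both to the matrix \<open>X\<close> and to the map \<open>[X,\<cdot>]\<close> on matrices.
\<close>

lemma top_singular_pair:
  fixes L :: "'a::euclidean_space \<Rightarrow> 'b::euclidean_space" and L' :: "'b \<Rightarrow> 'a"
  assumes L: "linear L" and adj: "\<And>x y. L x \<bullet> y = x \<bullet> L' y"
  obtains u v s where "norm u = 1" "norm v = 1" "s \<ge> 0" "L v = s *\<^sub>R u" "L' u = s *\<^sub>R v"
    "\<And>w. norm (L w) \<le> s * norm w"
proof -
  have cont: "continuous_on A L" for A
    using L by (simp add: linear_continuous_on linear_conv_bounded_linear)
  have "compact (sphere (0::'a) 1)" "sphere (0::'a) 1 \<noteq> {}"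
    by simp_all
  then obtain v where v: "norm v = 1" and vmax: "\<And>w. norm w = 1 \<Longrightarrow> norm (L w) \<le> norm (L v)"
    using continuous_attains_sup[of "sphere (0::'a) 1" "\<lambda>w. norm (L w)"]
      continuous_on_norm[OF cont] by auto
  define s where "s = norm (L v)"
  have bound: "norm (L w) \<le> s * norm w" for w
  proof (cases "w = 0")
    case True
    then show ?thesis using linear_0[OF L] by simp
  next
    case False
    then have "norm (L (inverse (norm w) *\<^sub>R w)) \<le> s"
      unfolding s_def by (intro vmax) simp
    then show ?thesis
      using False by (simp add: linear_cmul[OF L] field_simps)
  qed
  obtain u :: 'b where u: "norm u = 1" and Lv: "L v = s *\<^sub>R u"
  proof (cases "L v = 0")
    case True
    then show ?thesis using that[of "SOME b. b \<in> Basis"] by (simp add: s_def SOME_Basis)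
  next
    case False
    then show ?thesis using that[of "inverse s *\<^sub>R L v"] by (simp add: s_def)
  qed
  have "norm (L' u) * norm (L' u) = L (L' u) \<bullet> u"
    by (simp add: adj flip: dot_square_norm power2_eq_square)
  also have "\<dots> \<le> norm (L (L' u)) * norm u"
    by (rule norm_cauchy_schwarz)
  also have "\<dots> \<le> s * norm (L' u)"
    using bound u by simp
  finally have n: "norm (L' u) \<le> s"
    using mult_right_le_imp_le[of "norm (L' u)" "norm (L' u)" s]
    by (cases "norm (L' u) = 0") (auto simp: s_def)
  have "v \<bullet> L' u = s"
    using u by (simp add: Lv dot_square_norm flip: adj)
  then have "(norm (L' u - s *\<^sub>R v))\<^sup>2 = (norm (L' u))\<^sup>2 - s\<^sup>2"
    using dot_norm_neg[of "L' u" "s *\<^sub>R v"] v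
    by (simp add: inner_commute[of v] power_mult_distrib) (simp add: power2_eq_square)
  also have "\<dots> \<le> 0"
    using n by (simp add: power_mono)
  finally have "L' u = s *\<^sub>R v" by simp
  then show thesis
    using that[OF u v _ Lv _ bound] by (simp add: s_def)
qed

section \<open>The Hilbert-Schmidt inner product\<close>

lemma matrix_mult_linear:
  fixes A B C :: "real^'n^'n"
  shows "(A + B) ** C = A ** C + B ** C" "(A - B) ** C = A ** C - B ** C"
    "C ** (A + B) = C ** A + C ** B" "C ** (A - B) = C ** A - C ** B"
    "(c *\<^sub>R A) ** C = c *\<^sub>R (A ** C)" "C ** (c *\<^sub>R A) = c *\<^sub>R (C ** A)"
    "0 ** C = 0" "C ** 0 = 0"
  by (simp_all add: vec_eq_iff matrix_matrix_mult_def algebra_simps sum.distrib sum_subtractf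
      sum_distrib_left)

lemma transpose_linear:
  fixes A B :: "real^'n^'n"
  shows "transpose (A + B) = transpose A + transpose B"
    "transpose (A - B) = transpose A - transpose B"
    "transpose (c *\<^sub>R A) = c *\<^sub>R transpose A"
  by (simp_all add: vec_eq_iff transpose_def)

lemma inner_transpose:
  fixes A B :: "real^'n^'n"
  shows "transpose A \<bullet> transpose B = A \<bullet> B"
  unfolding inner_vec_def transpose_def by (simp, rule sum.swap)

lemma norm_transpose:
  fixes A :: "real^'n^'n"
  shows "norm (transpose A) = norm A"
  by (simp add: norm_eq_sqrt_inner inner_transpose)

lemma inner_matrix_mult_right:
  fixes A B C :: "real^'n^'n"
  shows "(A ** B) \<bullet> C = A \<bullet> (C ** transpose B)"
proof -
  have "(\<Sum>j\<in>UNIV. \<Sum>k\<in>UNIV. A$i$k * B$k$j * C$i$j) = (\<Sum>k\<in>UNIV. \<Sum>j\<in>UNIV. A$i$k * B$k$j * C$i$j)"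
    for i by (rule sum.swap)
  then show ?thesis
    by (simp add: inner_vec_def transpose_def matrix_matrix_mult_def sum_distrib_left
        sum_distrib_right ac_simps)
qed

lemma inner_matrix_mult_left:
  fixes A B C :: "real^'n^'n"
  shows "(A ** B) \<bullet> C = B \<bullet> (transpose A ** C)"
  using inner_matrix_mult_right[of "transpose B" "transpose A" "transpose C"]
    inner_transpose[of "A ** B" C] inner_transpose[of B "transpose A ** C"]
  by (simp add: matrix_transpose_mul)

lemma norm_le_rowwise:
  fixes x :: "('a::real_normed_vector)^'n" and y :: "('b::real_normed_vector)^'n"
  assumes "\<And>i. norm (x $ i) \<le> norm (y $ i)"
  shows "norm x \<le> norm y"
  using assms by (simp add: norm_vec_def L2_set_mono)

lemma norm_matrix_mult_le_left:
  fixes A M :: "real^'n^'n"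
  assumes "\<And>w. norm (A *v w) \<le> c * norm w" "c \<ge> 0"
  shows "norm (A ** M) \<le> c * norm M"
proof -
  have col: "transpose (A ** M) $ j = A *v (transpose M $ j)" for j
    by (simp add: vec_eq_iff transpose_def matrix_matrix_mult_def matrix_vector_mult_def)
  have "norm (transpose (A ** M)) \<le> norm (c *\<^sub>R transpose M)"
    by (rule norm_le_rowwise) (simp add: col assms)
  then show ?thesis
    using assms(2) by (simp add: norm_transpose)
qed

lemma norm_matrix_vector_le:
  fixes A :: "real^'n^'n"
  shows "norm (A *v w) \<le> norm A * norm w"
proof -
  have "norm ((A *v w) $ i) \<le> norm ((\<chi> i. norm w * norm (A $ i)) $ i)" for i
    using Cauchy_Schwarz_ineq2[of "A $ i" w] by (simp add: matrix_vector_mul_component mult.commute)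
  then have "norm (A *v w) \<le> norm (\<chi> i. norm w * norm (A $ i))"
    by (rule norm_le_rowwise)
  also have "\<dots> = norm A * norm w"
    by (simp add: norm_vec_def[of A] norm_vec_def[of "\<chi> i. norm w * norm (A $ i)"]
        L2_set_right_distrib mult.commute)
  finally show ?thesis .
qed

lemma norm_projection_split:
  fixes P A :: "real^'n^'n"
  assumes "transpose P = P" "P ** P = P"
  shows "(norm A)\<^sup>2 = (norm (P ** A))\<^sup>2 + (norm ((mat 1 - P) ** A))\<^sup>2"
    and "(norm A)\<^sup>2 = (norm (A ** P))\<^sup>2 + (norm (A ** (mat 1 - P)))\<^sup>2"
proof -
  have *: "(norm B)\<^sup>2 = (norm (P ** B))\<^sup>2 + (norm ((mat 1 - P) ** B))\<^sup>2" for B :: "real^'n^'n"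
  proof -
    have "(P ** B) \<bullet> ((mat 1 - P) ** B) = 0"
      by (simp add: inner_matrix_mult_left assms matrix_mult_linear matrix_mul_assoc)
    moreover have "B = P ** B + (mat 1 - P) ** B"
      by (simp add: matrix_mult_linear)
    ultimately show ?thesis
      by (metis norm_add_Pythagorean orthogonal_def)
  qed
  show "(norm A)\<^sup>2 = (norm (P ** A))\<^sup>2 + (norm ((mat 1 - P) ** A))\<^sup>2" by (rule *)
  have "transpose (mat 1 - P) = mat 1 - P"
    by (simp add: transpose_linear assms)
  then show "(norm A)\<^sup>2 = (norm (A ** P))\<^sup>2 + (norm (A ** (mat 1 - P)))\<^sup>2"
    using *[of "transpose A"] norm_transpose[of "A ** P"] norm_transpose[of "A ** (mat 1 - P)"]
    by (simp add: matrix_transpose_mul norm_transpose assms)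
qed

section \<open>Rank one matrices\<close>

definition outer :: "real^'n \<Rightarrow> real^'n \<Rightarrow> real^'n^'n" where
  "outer a b = (\<chi> i j. a $ i * b $ j)"

lemma outer_mult:
  "A ** outer a b = outer (A *v a) b"
  "outer a b ** A = outer a (b v* A)"
  by (simp_all add: outer_def vec_eq_iff matrix_matrix_mult_def matrix_vector_mult_def
      vector_matrix_mult_def sum_distrib_left sum_distrib_right ac_simps)

lemma outer_vec: "outer a b *v x = (b \<bullet> x) *\<^sub>R a"
  by (simp add: outer_def vec_eq_iff matrix_vector_mult_def inner_vec_def sum_distrib_left
      sum_distrib_right ac_simps)

lemma outer_scaleR: "outer (c *\<^sub>R a) b = c *\<^sub>R outer a b" "outer a (c *\<^sub>R b) = c *\<^sub>R outer a b"
  by (simp_all add: outer_def vec_eq_iff)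

lemma transpose_outer: "transpose (outer a b) = outer b a"
  by (simp add: outer_def transpose_def vec_eq_iff mult.commute)

lemma norm_outer: "norm (outer a b) = norm a * norm b"
proof -
  have "outer a b $ i = (a $ i) *\<^sub>R b" for i
    by (simp add: outer_def vec_eq_iff)
  then show ?thesis
    by (simp add: norm_vec_def[of "outer a b"] norm_vec_def[of a] L2_set_left_distrib)
qed

section \<open>The inequality under a linear condition on the second matrix\<close>

lemma square_le_Cauchy_Schwarz:
  fixes a b p q r :: real
  assumes "p \<ge> 0" "q \<ge> 0" "r \<le> p * a + q * b" "r \<ge> 0"
  shows "r\<^sup>2 \<le> (p\<^sup>2 + q\<^sup>2) * (a\<^sup>2 + b\<^sup>2)"
proof -
  have "r\<^sup>2 \<le> (p * a + q * b)\<^sup>2"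
    using assms by (intro power_mono) auto
  also have "\<dots> = (p\<^sup>2 + q\<^sup>2) * (a\<^sup>2 + b\<^sup>2) - (p * b - q * a)\<^sup>2"
    by algebra
  finally show ?thesis by (smt (verit) zero_le_power2)
qed

text \<open>
  The last hypothesis compares the \<open>(1,1)\<close> entries of \<open>Y\<close> in two orthonormal bases, the left and the
  right singular basis of \<open>X\<close>.  It removes the one block of the commutator in which both products
  carry the large factor \<open>s\<close>, and for which the argument would give only \<open>2 s\<^sup>2\<close> in place of \<open>\<parallel>X\<parallel>\<^sup>2\<close>.
\<close>

lemma commutator_bound_of_diagonal_eq:
  fixes X Y :: "real^'n^'n"
  assumes u: "norm u = 1" and v: "norm v = 1" and s: "s \<ge> 0"
    and Xv: "X *v v = s *\<^sub>R u" and Xu: "u v* X = s *\<^sub>R v"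
    and top: "\<And>w. norm (X *v w) \<le> s * norm w"
    and diag: "v \<bullet> (Y *v v) = u \<bullet> (Y *v u)"
  shows "(norm (commutator X Y))\<^sup>2 \<le> 2 * (norm X)\<^sup>2 * (norm Y)\<^sup>2"
proof -
  define P where "P = outer u u"
  define Q where "Q = outer v v"
  define J where "J = outer u v"
  define P' where "P' = mat 1 - P"
  define Q' where "Q' = mat 1 - Q"
  define X' where "X' = X - s *\<^sub>R J"
  define Z where "Z = commutator X Y"
  have uu: "u \<bullet> u = 1" and vv: "v \<bullet> v = 1"
    using u v by (simp_all add: dot_square_norm)
  have PQ: "transpose P = P" "P ** P = P" "transpose Q = Q" "Q ** Q = Q"
    by (simp_all add: P_def Q_def transpose_outer outer_mult outer_vec uu vv)
  note splitP = norm_projection_split[OF PQ(1,2), folded P'_def]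
  note splitQ = norm_projection_split[OF PQ(3,4), folded Q'_def]
  have PX: "P ** X = s *\<^sub>R J" and XQ: "X ** Q = s *\<^sub>R J"
    by (simp_all add: P_def Q_def J_def outer_mult Xv Xu outer_scaleR)
  have P'X: "P' ** X = X'" and XQ': "X ** Q' = X'"
    by (simp_all add: P'_def Q'_def X'_def matrix_mult_linear PX XQ)
  have idem: "P' ** P' = P'" "Q' ** Q' = Q'"
    by (simp_all add: P'_def Q'_def matrix_mult_linear PQ)
  have X'_absorb: "P' ** X' = X'" "X' ** Q' = X'"
    using P'X XQ' idem by (metis matrix_mul_assoc)+
  have normX: "(norm X)\<^sup>2 = s\<^sup>2 + (norm X')\<^sup>2"
    using splitP(1)[of X] by (simp add: PX P'X J_def norm_outer u v)

  \<comment> \<open>Both bounds on \<open>X'\<close> are needed: \<open>q \<le> \<parallel>X'\<parallel>\<close> yields \<open>s\<^sup>2 + q\<^sup>2 \<le> \<parallel>X\<parallel>\<^sup>2\<close> for the mixed blocks,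
    and then \<open>q \<le> s\<close> yields \<open>2 q\<^sup>2 \<le> \<parallel>X\<parallel>\<^sup>2\<close> for the last block.\<close>
  define q where "q = min s (norm X')"
  have q: "q \<ge> 0" "s\<^sup>2 + q\<^sup>2 \<le> (norm X)\<^sup>2" "q\<^sup>2 + q\<^sup>2 \<le> (norm X)\<^sup>2"
  proof -
    show "q \<ge> 0" using s by (simp add: q_def)
    then have "q\<^sup>2 \<le> s\<^sup>2" "q\<^sup>2 \<le> (norm X')\<^sup>2"
      by (simp_all add: q_def power_mono)
    then show "s\<^sup>2 + q\<^sup>2 \<le> (norm X)\<^sup>2" "q\<^sup>2 + q\<^sup>2 \<le> (norm X)\<^sup>2"
      using normX by linarith+
  qed
  have le_P': "norm (P' ** M) \<le> norm M" for M :: "real^'n^'n"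
    using splitP(1)[of M] by (smt (verit) norm_ge_zero power2_le_imp_le zero_le_power2)
  have X'_left: "norm (X' ** M) \<le> q * norm M" for M :: "real^'n^'n"
  proof -
    have "norm (X' ** M) \<le> norm X' * norm M"
      by (intro norm_matrix_mult_le_left norm_matrix_vector_le norm_ge_zero)
    moreover have "norm (X' ** M) \<le> s * norm M"
      using le_P'[of "X ** M"] norm_matrix_mult_le_left[OF top s, of M]
      by (simp add: matrix_mul_assoc P'X)
    ultimately show ?thesis by (simp add: q_def min_def)
  qed
  \<comment> \<open>The adjoint of \<open>M \<mapsto> M X'\<close> sends \<open>M\<close> to \<open>(X' M\<^sup>T)\<^sup>T\<close>, and a map has the same norm as its adjoint.\<close>
  have X'_right: "norm (M ** X') \<le> q * norm M" for M :: "real^'n^'n"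
  proof -
    have "(norm (M ** X'))\<^sup>2 = M \<bullet> transpose (X' ** transpose (M ** X'))"
      using inner_matrix_mult_right[of M X' "M ** X'"]
      by (simp add: power2_norm_eq_inner matrix_transpose_mul matrix_mul_assoc)
    also have "\<dots> = (X' ** transpose (M ** X')) \<bullet> transpose M"
      by (metis inner_commute inner_transpose transpose_transpose)
    also have "\<dots> \<le> norm (X' ** transpose (M ** X')) * norm (transpose M)"
      by (rule norm_cauchy_schwarz)
    also have "\<dots> \<le> (q * norm (M ** X')) * norm M"
      using X'_left[of "transpose (M ** X')"] by (simp add: norm_transpose mult_right_mono)
    finally have "norm (M ** X') * norm (M ** X') \<le> (q * norm M) * norm (M ** X')"
      by (simp add: power2_eq_square ac_simps)
    then show ?thesis
      using q(1) by (cases "norm (M ** X') = 0") (auto dest: mult_right_le_imp_le)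
  qed
  have J_left: "norm (J ** M) = norm (Q ** M)" for M :: "real^'n^'n"
    by (simp add: J_def Q_def outer_mult norm_outer u v)
  have J_right: "norm (M ** J) = norm (M ** P)" for M :: "real^'n^'n"
    by (simp add: J_def P_def outer_mult norm_outer u v)

  have Z: "Z = X ** Y - Y ** X"
    by (simp add: Z_def commutator_def)
  have assoc: "P ** (X ** M) = s *\<^sub>R (J ** M)" "P' ** (X ** M) = X' ** M"
    "X' ** (Q' ** M) = X' ** M" for M :: "real^'n^'n"
    by (simp_all add: matrix_mul_assoc PX P'X X'_absorb matrix_mult_linear)
  note block_simps = Z matrix_mult_linear assoc XQ XQ' X'_absorb
  have "J ** (Y ** Q) = P ** (Y ** J)"
    using diag by (simp add: J_def P_def Q_def outer_mult outer_scaleR outer_vec dot_lmul_matrix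
        inner_commute flip: matrix_vector_mul_assoc)
  then have Z11: "P ** Z ** Q = 0"
    by (simp add: block_simps flip: matrix_mul_assoc)
  have Z12: "P ** Z ** Q' = s *\<^sub>R (J ** (Y ** Q')) - (P ** Y ** P') ** X'"
    by (simp add: block_simps flip: matrix_mul_assoc)
  have Z21: "P' ** Z ** Q = X' ** (Q' ** Y ** Q) - s *\<^sub>R ((P' ** Y) ** J)"
    by (simp add: block_simps flip: matrix_mul_assoc)
  have Z22: "P' ** Z ** Q' = X' ** (Q' ** Y ** Q') - (P' ** Y ** P') ** X'"
    by (simp add: block_simps flip: matrix_mul_assoc)

  have B12: "(norm (P ** Z ** Q'))\<^sup>2
      \<le> (norm X)\<^sup>2 * ((norm (Q ** Y ** Q'))\<^sup>2 + (norm (P ** Y ** P'))\<^sup>2)"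
  proof -
    have "norm (P ** Z ** Q') \<le> s * norm (Q ** Y ** Q') + q * norm (P ** Y ** P')"
      unfolding Z12 using norm_triangle_ineq4 X'_right[of "P ** Y ** P'"] s
      by (smt (verit) J_left matrix_mul_assoc norm_scaleR)
    from square_le_Cauchy_Schwarz[OF s q(1) this] show ?thesis
      by (smt (verit) mult_right_mono norm_ge_zero q(2) zero_le_power2)
  qed
  have B21: "(norm (P' ** Z ** Q))\<^sup>2
      \<le> (norm X)\<^sup>2 * ((norm (Q' ** Y ** Q))\<^sup>2 + (norm (P' ** Y ** P))\<^sup>2)"
  proof -
    have "norm (P' ** Z ** Q) \<le> q * norm (Q' ** Y ** Q) + s * norm (P' ** Y ** P)"
      unfolding Z21 using norm_triangle_ineq4 X'_left[of "Q' ** Y ** Q"] s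
      by (smt (verit) J_right norm_scaleR)
    from square_le_Cauchy_Schwarz[OF q(1) s this] show ?thesis
      by (smt (verit) mult_right_mono norm_ge_zero q(2) zero_le_power2)
  qed
  have B22: "(norm (P' ** Z ** Q'))\<^sup>2
      \<le> (norm X)\<^sup>2 * ((norm (Q' ** Y ** Q'))\<^sup>2 + (norm (P' ** Y ** P'))\<^sup>2)"
  proof -
    have "norm (P' ** Z ** Q') \<le> q * norm (Q' ** Y ** Q') + q * norm (P' ** Y ** P')"
      unfolding Z22 using norm_triangle_ineq4 X'_left[of "Q' ** Y ** Q'"]
        X'_right[of "P' ** Y ** P'"]
      by (smt (verit))
    from square_le_Cauchy_Schwarz[OF q(1) q(1) this] show ?thesis
      by (smt (verit) mult_right_mono norm_ge_zero q(3) zero_le_power2)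
  qed

  have splitY: "(norm (Q ** Y ** Q'))\<^sup>2 + (norm (Q' ** Y ** Q))\<^sup>2 + (norm (Q' ** Y ** Q'))\<^sup>2 \<le> (norm Y)\<^sup>2"
     "(norm (P ** Y ** P'))\<^sup>2 + (norm (P' ** Y ** P))\<^sup>2 + (norm (P' ** Y ** P'))\<^sup>2 \<le> (norm Y)\<^sup>2"
    using splitQ(1)[of Y] splitQ(2)[of "Q ** Y"] splitQ(2)[of "Q' ** Y"]
      splitP(1)[of Y] splitP(2)[of "P ** Y"] splitP(2)[of "P' ** Y"]
      zero_le_power2[of "norm (Q ** Y ** Q)"] zero_le_power2[of "norm (P ** Y ** P)"]
    by linarith+
  have "(norm Z)\<^sup>2 = (norm (P ** Z ** Q'))\<^sup>2 + (norm (P' ** Z ** Q))\<^sup>2 + (norm (P' ** Z ** Q'))\<^sup>2"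
    using splitP(1)[of Z] splitQ(2)[of "P ** Z"] splitQ(2)[of "P' ** Z"] by (simp add: Z11)
  also have "\<dots> \<le> (norm X)\<^sup>2 * (((norm (Q ** Y ** Q'))\<^sup>2 + (norm (Q' ** Y ** Q))\<^sup>2 + (norm (Q' ** Y ** Q'))\<^sup>2)
     + ((norm (P ** Y ** P'))\<^sup>2 + (norm (P' ** Y ** P))\<^sup>2 + (norm (P' ** Y ** P'))\<^sup>2))"
    using B12 B21 B22 by (simp add: algebra_simps)
  also have "\<dots> \<le> (norm X)\<^sup>2 * ((norm Y)\<^sup>2 + (norm Y)\<^sup>2)"
    using splitY by (intro mult_left_mono add_mono) simp_all
  finally show ?thesis by (simp add: Z_def)
qed

section \<open>The plane of maximisers\<close>

lemma commutator_linear: "linear (commutator X)"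
  by (intro linearI) (simp_all add: commutator_def matrix_mult_linear algebra_simps)

lemma inner_commutator: "commutator X A \<bullet> B = A \<bullet> commutator (transpose X) B"
  by (simp add: commutator_def inner_diff_left inner_diff_right inner_matrix_mult_left[of X]
      inner_matrix_mult_right[of A X])

lemma transpose_commutator: "transpose (commutator X A) = - commutator (transpose X) (transpose A)"
  by (simp add: commutator_def transpose_linear matrix_transpose_mul)

text \<open>
  This is \<open>tr([X,Y] Y) = 0\<close>, which holds because the trace is cyclic.
\<close>

lemma inner_commutator_transpose_self:
  fixes X Y :: "real^'n^'n"
  shows "commutator X Y \<bullet> transpose Y = 0"
  by (simp add: commutator_def inner_diff_left inner_matrix_mult_left[of Y X]
     inner_matrix_mult_right[of X Y])

theorem mainTheorem3:
  fixes X Y :: "real ^ 'n ^ 'n"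
  shows "(hs_norm (commutator X Y))\<^sup>2 \<le> 2 * (hs_norm X)\<^sup>2 * (hs_norm Y)\<^sup>2"
proof -
  obtain u v s where uv: "norm u = 1" "norm v = 1" "s \<ge> 0" "X *v v = s *\<^sub>R u" "u v* X = s *\<^sub>R v"
    and top: "\<And>w. norm (X *v w) \<le> s * norm w"
    using top_singular_pair[of "(*v) X" "\<lambda>w. w v* X"]
    by (metis dot_lmul_matrix inner_commute matrix_vector_mul_linear)
  obtain B A m where AB: "norm B = 1" "norm A = 1" "m \<ge> 0"
      "commutator X A = m *\<^sub>R B" "commutator (transpose X) B = m *\<^sub>R A"
    and max: "\<And>W. norm (commutator X W) \<le> m * norm W"
    using top_singular_pair[OF commutator_linear inner_commutator] by metis
  have "m\<^sup>2 \<le> 2 * (norm X)\<^sup>2"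
  proof (cases "m = 0")
    case True
    then show ?thesis by simp
  next
    case False
    define C where "C = transpose B"
    have XC: "commutator X C = - m *\<^sub>R transpose A"
      using transpose_commutator[of "transpose X" B] AB(5)
      by (simp add: C_def transpose_linear)
    have BA: "B \<bullet> transpose A = 0"
      using inner_commutator_transpose_self[of X A] AB(4) False by simp
    have AC: "A \<bullet> C = 0"
      using BA inner_transpose[of B "transpose A"] by (simp add: C_def inner_commute)
    define f where "f = (\<lambda>W::real^'n^'n. v \<bullet> (W *v v) - u \<bullet> (W *v u))"
    \<comment> \<open>A nonzero point of the plane in the kernel of the linear functional \<open>f\<close>.\<close>
    obtain a b where ab: "a\<^sup>2 + b\<^sup>2 \<noteq> 0" "a * f A + b * f C = 0"
    proof (cases "f A = 0")
      case True
      then show ?thesis using that[of 1 0] by simp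
    next
      case False
      then show ?thesis using that[of "f C" "- f A"] by (simp add: sum_power2_eq_zero_iff)
    qed
    define W where "W = a *\<^sub>R A + b *\<^sub>R C"
    have nW: "(norm W)\<^sup>2 = a\<^sup>2 + b\<^sup>2"
      using AC AB(1,2) by (simp add: W_def power2_norm_eq_inner inner_add inner_commute)
        (simp add: C_def norm_transpose dot_square_norm power2_eq_square)
    have XW: "commutator X W = m *\<^sub>R (a *\<^sub>R B - b *\<^sub>R transpose A)"
      by (simp add: W_def linear_add[OF commutator_linear] linear_cmul[OF commutator_linear]
         AB XC scaleR_diff_right mult.commute)
    have "(norm (a *\<^sub>R B - b *\<^sub>R transpose A))\<^sup>2 = a\<^sup>2 + b\<^sup>2"
      using BA AB(1,2) by (simp add: power2_norm_eq_inner inner_diff inner_commute)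
        (simp add: norm_transpose dot_square_norm power2_eq_square)
    then have nXW: "(norm (commutator X W))\<^sup>2 = m\<^sup>2 * (a\<^sup>2 + b\<^sup>2)"
      by (simp add: XW power_mult_distrib)
    have "f W = 0"
      using ab(2) by (simp add: f_def W_def matrix_vector_mult_add_rdistrib inner_add_right
         algebra_simps flip: scaleR_matrix_vector_assoc)
    then have "m\<^sup>2 * (a\<^sup>2 + b\<^sup>2) \<le> 2 * (norm X)\<^sup>2 * (a\<^sup>2 + b\<^sup>2)"
      using commutator_bound_of_diagonal_eq[OF uv top, of W] by (simp add: f_def nW nXW)
    moreover have "a\<^sup>2 + b\<^sup>2 > 0"
      using ab(1) by (simp add: sum_power2_gt_zero_iff)
    ultimately show ?thesis by (rule mult_right_le_imp_le)
  qed
  then have "m\<^sup>2 * (norm Y)\<^sup>2 \<le> 2 * (norm X)\<^sup>2 * (norm Y)\<^sup>2"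
    by (intro mult_right_mono) simp_all
  moreover have "(norm (commutator X Y))\<^sup>2 \<le> (m * norm Y)\<^sup>2"
    by (intro power_mono max) simp
  ultimately show ?thesis
    by (simp add: hs_norm_eq_norm power_mult_distrib)
qed

end
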